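(* Let $\{c_{i,N}^n\}_{i=1}^m,\Phi_N^n,\mathbf u_N^n,p_N^n,r_N^n$ be given. Suppose $c_{i,N}^n>0$ and $(c_{i,N}^n,1)_N=(c_{i,N}^0,1)_N$ for $i=1,\dots,m$. Then the solution $(\{c_{i,N}^{n+1}\},\mathbf u_N^{n+1},p_N^{n+1},r_N^{n+1})$ of Scheme1-SM (defined in the context, with arbitrary time step $\Delta t>0$) satisfies the following properties: (i) Positivity preserving: $c_{i,N}^{n+1}>0$, $i=1,\dots,m$. (ii) Mass conserving: $(c_{i,N}^{n+1},1)_N=(c_{i,N}^n,1)_N$, $i=1,\dots,m$. (iii) Energy dissipation: $\mathcal E_N^{n+1}-\mathcal E_N^n\le0$, where $$\mathcal E_N^{n+1}:=\|\mathbf u_N^{n+1}\|_{0,N}^2+\Delta t^2\|\nabla p_N^{n+1}\|_{0,N}^2+|r_N^{n+1}|^2 .$$ (iv) The quantities $\|\mathbf u_N^n\|_{0,N}$, $|r_N^n|$ and $|\xi_N^n|$ are bounded for all $n\ge0$.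
   Context: $\Omega=(-1,1)^2$; $m\ge1$ is an integer; $z_i\in\mathbb R$, $D_i>0$ ($i=1,\dots,m$), $\epsilon>0$, $\nu>0$ are constants; $\Delta t>0$ is the time step size and $n\ge0$ the time step index. $\mathbb P_N(\Omega)$ is the space of polynomials on $\Omega$ of degree $\le N$ in each variable. $X_N=\mathbb P_N(\Omega)$, $\mathbf X_N=X_N^2$, $X_N^0=\{v\in X_N: v|_{\partial\Omega}=0\}$, $\mathbf X_N^0=(X_N^0)^2$, $M_N=\{v\in\mathbb P_N(\Omega):\int_\Omega v\,dx=0\}$, and $M_{N-2}$ is defined likewise with $N-2$ in place of $N$. $(\cdot,\cdot)_N$ is the discrete inner product given by the tensor-product Legendre–Gauss–Lobatto quadrature with $N+1$ points in each direction (componentwise sum for vectors), and $\|\cdot\|_{0,N}=(\cdot,\cdot)_N^{1/2}$. Define $$E_{npp}[\{c_i\},\Phi]=\int_\Omega\Big[\sum_{i=1}^m c_i(\log c_i-1)+\tfrac12\Big(\sum_{i=1}^m z_ic_i\Big)\Phi\Big]dx ,$$ and let $C_0>0$ be a constant such that $E_{npp}[\{c_i\},\Phi]+C_0\ge1$. Data known at level $n$: $\sigma_{i,N}^n\in X_N$, functions $c_{i,N}^n$, $\Phi_N^n\in M_N$, $\mathbf u_N^n\in\mathbf X_N$, $p_N^n\in M_{N-2}$, $r_N^n\in\mathbb R$. The scheme is applied successively for $n\ge0$ from the initial data. Notation: $\bar\mu_{i,N}^{n+1}=\log c_{i,N}^{n+1}+z_i\bar\Phi_N^{n+1}$, $\bar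 E_{npp,N}^{n+1}=E_{npp}[\{c_{i,N}^{n+1}\},\bar\Phi_N^{n+1}]$, $\xi_N^{n+1}=r_N^{n+1}/\sqrt{\bar E_{npp,N}^{n+1}+C_0}$ (with $\xi_N^0$ a finite number coming from the initial data). Scheme1-SM: find $\sigma_{i,N}^{n+1}\in X_N$, functions $c_{i,N}^{n+1}$, $\bar\Phi_N^{n+1},\Phi_N^{n+1}\in M_N$, $\tilde{\mathbf u}_N^{n+1}\in\mathbf X_N^0$, $\mathbf u_N^{n+1}\in\mathbf X_N$, $\psi_N^{n+1},p_N^{n+1}\in M_{N-2}$, $r_N^{n+1}\in\mathbb R$ such that, for $i=1,\dots,m$: (a) $\Big(\dfrac{\sigma_{i,N}^{n+1}-\sigma_{i,N}^n}{\Delta t},w_N\Big)_N+D_i(\nabla\sigma_{i,N}^{n+1},\nabla w_N)_N=\Big(D_i\big[|\nabla\sigma_{i,N}^n|^2+z_i(\nabla\sigma_{i,N}^n\cdot\nabla\Phi_N^n+\Delta\Phi_N^n)\big]-\nabla\cdot(\sigma_{i,N}^n\mathbf u_N^n),w_N\Big)_N$ for all $w_N\in X_N$; (b) $\bar c_{i,N}^{n+1}=\exp(\sigma_{i,N}^{n+1})$, $\ \lambda_{i,N}^{n+1}(\bar c_{i,N}^{n+1},1)_N-(c_{i,N}^n,1)_N=0$ with $\lambda_{i,N}^{n+1}\in\mathbb R$, $\ c_{i,N}^{n+1}=\lambda_{i,N}^{n+1}\bar c_{i,N}^{n+1}$; (c) $\epsilon(\nabla\bar\Phi_N^{n+1},\nabla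 q_N)_N=\big(\sum_{i=1}^m z_ic_{i,N}^{n+1},q_N\big)_N$ for all $q_N\in M_N$; (d) $\Big(\dfrac{\tilde{\mathbf u}_N^{n+1}-\mathbf u_N^n}{\Delta t},\mathbf v_N\Big)_N+\xi_N^{n+1}\Big((\mathbf u_N^n\cdot\nabla)\mathbf u_N^n+\big(\sum_{i=1}^m z_ic_{i,N}^{n+1}\big)\nabla\bar\Phi_N^{n+1},\mathbf v_N\Big)_N+\nu(\nabla\tilde{\mathbf u}_N^{n+1},\nabla\mathbf v_N)_N+(\nabla p_N^n,\mathbf v_N)_N=0$ for all $\mathbf v_N\in\mathbf X_N^0$; (e) $(\nabla\psi_N^{n+1},\nabla q_N)_N=\frac1{\Delta t}(\tilde{\mathbf u}_N^{n+1},\nabla q_N)_N$ for all $q_N\in M_{N-2}$; $\ \mathbf u_N^{n+1}=\tilde{\mathbf u}_N^{n+1}-\Delta t\nabla\psi_N^{n+1}$; $\ p_N^{n+1}=\psi_N^{n+1}+p_N^n$; (f) $\dfrac{r_N^{n+1}-r_N^n}{\Delta t}=-\dfrac1{2\sqrt{\bar E_{npp,N}^{n+1}+C_0}}\Big[\xi_N^{n+1}\sum_{i=1}^m D_i\big(c_{i,N}^{n+1},|\nabla\bar\mu_{i,N}^{n+1}|^2\big)_N-\Big(\big(\sum_{i=1}^m z_ic_{i,N}^{n+1}\big)\nabla\bar\Phi_N^{n+1},\tilde{\mathbf u}_N^{n+1}\Big)_N-\big((\mathbf u_N^n\cdot\nabla)\mathbf u_N^n,\tilde{\mathbf u}_N^{n+1}\big)_N\Big]$;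 (g) $\Phi_N^{n+1}=\xi_N^{n+1}\bar\Phi_N^{n+1}$.
   Formalization: In (iii) the energy is taken as ||u||^2 + Δt^2||∇p||^2 + 2|r|^2 instead of with |r|^2: with coefficient 1 the dissipation claim is false for the scheme as given, since the coupling terms of (d) and (f) do not cancel. *)

theory Defs
  imports "HOL-Analysis.Analysis" "HOL-Computational_Algebra.Polynomial"
begin

text \<open>
  Functions on the closed square are represented by total functions on the plane: polynomials by
  their polynomial extension, and exponentials of polynomials by the same formula on the plane.
  Hence gradients are also defined at the quadrature nodes on the boundary.
\<close>

type_synonym scalar_fun = "real^2 \<Rightarrow> real"
type_synonym vector_fun = "real^2 \<Rightarrow> real^2"

definition Omega :: "(real^2) set" where
  "Omega = {x. \<forall>j. -1 < x $ j \<and> x $ j < 1}"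


subsection \<open>Differential operators\<close>

definition grad :: "scalar_fun \<Rightarrow> vector_fun" where
  "grad f x = (\<chi> j. frechet_derivative f (at x) (axis j 1))"

text \<open>Row \<open>i\<close> of the Jacobian is the gradient of the \<open>i\<close>-th component.\<close>

definition jac :: "vector_fun \<Rightarrow> real^2 \<Rightarrow> real^2^2" where
  "jac u x = (\<chi> i. grad (\<lambda>y. u y $ i) x)"

definition divg :: "vector_fun \<Rightarrow> scalar_fun" where
  "divg u x = (\<Sum>j\<in>UNIV. jac u x $ j $ j)"

definition laplacian :: "scalar_fun \<Rightarrow> scalar_fun" where
  "laplacian f = divg (grad f)"

text \<open>\<open>(u \<cdot> \<nabla>) u\<close>; its \<open>i\<close>-th component is the sum of \<open>u\<^sub>j \<partial>\<^sub>j u\<^sub>i\<close> over \<open>j\<close>.\<close>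

definition convection :: "vector_fun \<Rightarrow> vector_fun" where
  "convection u x = jac u x *v u x"


subsection \<open>Polynomial spaces\<close>

definition X_space :: "nat \<Rightarrow> scalar_fun set" where
  "X_space N = {v. \<exists>a :: nat \<Rightarrow> nat \<Rightarrow> real.
      \<forall>x. v x = (\<Sum>i\<le>N. \<Sum>j\<le>N. a i j * (x $ 1) ^ i * (x $ 2) ^ j)}"

definition X0_space :: "nat \<Rightarrow> scalar_fun set" where
  "X0_space N = {v \<in> X_space N. \<forall>x\<in>frontier Omega. v x = 0}"

definition M_space :: "nat \<Rightarrow> scalar_fun set" where
  "M_space N = {v \<in> X_space N. integral Omega v = 0}"

definition vec_space :: "scalar_fun set \<Rightarrow> vector_fun set" where
  "vec_space V = {u. \<forall>i. (\<lambda>x. u x $ i) \<in> V}"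


subsection \<open>Legendre--Gauss--Lobatto quadrature\<close>

text \<open>Legendre polynomials by Bonnet's recursion.\<close>

fun legendre :: "nat \<Rightarrow> real poly" where
  "legendre 0 = 1"
| "legendre (Suc 0) = [:0, 1:]"
| "legendre (Suc (Suc n)) =
     smult ((2 * real n + 3) / (real n + 2)) ([:0, 1:] * legendre (Suc n))
     - smult ((real n + 1) / (real n + 2)) (legendre n)"

text \<open>
  For \<open>N \<ge> 1\<close> the \<open>N + 1\<close> nodes are the zeros of \<open>(1 - x\<^sup>2) L'\<^sub>N(x)\<close>, where \<open>L\<^sub>N\<close> is the Legendre
  polynomial of degree \<open>N\<close>, and the weight of the node \<open>x\<close> is \<open>2 / (N (N + 1) L\<^sub>N(x)\<^sup>2)\<close>.
\<close>

definition lgl_nodes :: "nat \<Rightarrow> real set" where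
  "lgl_nodes N = {x. (1 - x^2) * poly (pderiv (legendre N)) x = 0}"

definition lgl_weight :: "nat \<Rightarrow> real \<Rightarrow> real" where
  "lgl_weight N x = 2 / (real N * (real N + 1) * (poly (legendre N) x)^2)"

text \<open>
  The discrete inner product is used at value types \<open>real\<close>, \<open>real^2\<close> and (for \<open>(\<nabla>u, \<nabla>v)\<^sub>N\<close>)
  \<open>real^2^2\<close>; on the latter two, the inner product of values is the componentwise sum.
\<close>

definition dip :: "nat \<Rightarrow> (real^2 \<Rightarrow> 'a::real_inner) \<Rightarrow> (real^2 \<Rightarrow> 'a) \<Rightarrow> real" where
  "dip N f g = (\<Sum>s\<in>lgl_nodes N. \<Sum>t\<in>lgl_nodes N.
      lgl_weight N s * lgl_weight N t * (f (vector [s, t]) \<bullet> g (vector [s, t])))"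

definition dnorm :: "nat \<Rightarrow> (real^2 \<Rightarrow> 'a::real_inner) \<Rightarrow> real" where
  "dnorm N f = sqrt (dip N f f)"


subsection \<open>The scheme\<close>

text \<open>The ions are indexed by \<open>{1..ions}\<close>.\<close>

record params =
  ions :: nat
  valence :: "nat \<Rightarrow> real"        \<comment> \<open>\<open>z\<^sub>i\<close>\<close>
  diffusivity :: "nat \<Rightarrow> real"    \<comment> \<open>\<open>D\<^sub>i\<close>\<close>
  permittivity :: real           \<comment> \<open>\<open>\<epsilon>\<close>\<close>
  viscosity :: real              \<comment> \<open>\<open>\<nu>\<close>\<close>
  shift :: real                  \<comment> \<open>\<open>C\<^sub>0\<close>\<close>
  timestep :: real               \<comment> \<open>\<open>\<Delta>t\<close>\<close>
  deg :: nat                     \<comment> \<open>\<open>N\<close>\<close>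

record level =
  sigma :: "nat \<Rightarrow> scalar_fun"
  lam :: "nat \<Rightarrow> real"
  conc :: "nat \<Rightarrow> scalar_fun"     \<comment> \<open>\<open>c\<^sub>i\<close>\<close>
  phibar :: scalar_fun
  phi :: scalar_fun
  utilde :: vector_fun
  vel :: vector_fun              \<comment> \<open>\<open>u\<close>\<close>
  psi :: scalar_fun
  pres :: scalar_fun             \<comment> \<open>\<open>p\<close>\<close>
  sav :: real                    \<comment> \<open>\<open>r\<close>\<close>
  xi :: real

definition valid_params :: "params \<Rightarrow> bool" where
  "valid_params P \<longleftrightarrow>
     ions P \<ge> 1 \<and> (\<forall>i\<in>{1..ions P}. diffusivity P i > 0) \<and>
     permittivity P > 0 \<and> viscosity P > 0 \<and> shift P > 0 \<and> timestep P > 0 \<and> deg P \<ge> 2"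

definition level_data :: "params \<Rightarrow> level \<Rightarrow> bool" where
  "level_data P S \<longleftrightarrow>
     (\<forall>i\<in>{1..ions P}. sigma S i \<in> X_space (deg P)) \<and>
     phi S \<in> M_space (deg P) \<and>
     vel S \<in> vec_space (X_space (deg P)) \<and>
     pres S \<in> M_space (deg P - 2)"

definition charge :: "params \<Rightarrow> (nat \<Rightarrow> scalar_fun) \<Rightarrow> scalar_fun" where
  "charge P c x = (\<Sum>i=1..ions P. valence P i * c i x)"

definition E_npp :: "params \<Rightarrow> (nat \<Rightarrow> scalar_fun) \<Rightarrow> scalar_fun \<Rightarrow> real" where
  "E_npp P c \<Phi> = integral Omega (\<lambda>x.
     (\<Sum>i=1..ions P. c i x * (ln (c i x) - 1)) + 1 / 2 * charge P c x * \<Phi> x)"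

definition shifted_energy :: "params \<Rightarrow> level \<Rightarrow> real" where
  "shifted_energy P S = E_npp P (conc S) (phibar S) + shift P"

definition mubar :: "params \<Rightarrow> level \<Rightarrow> nat \<Rightarrow> scalar_fun" where
  "mubar P S i x = ln (conc S i x) + valence P i * phibar S x"

definition eq_sigma :: "params \<Rightarrow> level \<Rightarrow> level \<Rightarrow> bool" where
  "eq_sigma P S S' \<longleftrightarrow>
     (\<forall>i\<in>{1..ions P}. sigma S' i \<in> X_space (deg P) \<and>
       (\<forall>w\<in>X_space (deg P).
          dip (deg P) (\<lambda>x. (sigma S' i x - sigma S i x) / timestep P) w
          + diffusivity P i * dip (deg P) (grad (sigma S' i)) (grad w)
          = dip (deg P)
              (\<lambda>x. diffusivity P i *
                     ((norm (grad (sigma S i) x))^2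
                      + valence P i * (grad (sigma S i) x \<bullet> grad (phi S) x
                                       + laplacian (phi S) x))
                   - divg (\<lambda>y. sigma S i y *\<^sub>R vel S y) x) w))"

definition eq_conc :: "params \<Rightarrow> level \<Rightarrow> level \<Rightarrow> bool" where
  "eq_conc P S S' \<longleftrightarrow>
     (\<forall>i\<in>{1..ions P}.
       lam S' i * dip (deg P) (\<lambda>x. exp (sigma S' i x)) (\<lambda>_. 1)
         - dip (deg P) (conc S i) (\<lambda>_. 1) = 0 \<and>
       (\<forall>x. conc S' i x = lam S' i * exp (sigma S' i x)))"

definition eq_potential :: "params \<Rightarrow> level \<Rightarrow> bool" where
  "eq_potential P S' \<longleftrightarrow>
     phibar S' \<in> M_space (deg P) \<and>
     (\<forall>q\<in>M_space (deg P).
        permittivity P * dip (deg P) (grad (phibar S')) (grad q)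
        = dip (deg P) (charge P (conc S')) q)"

definition eq_velocity :: "params \<Rightarrow> level \<Rightarrow> level \<Rightarrow> bool" where
  "eq_velocity P S S' \<longleftrightarrow>
     utilde S' \<in> vec_space (X0_space (deg P)) \<and>
     (\<forall>v\<in>vec_space (X0_space (deg P)).
        dip (deg P) (\<lambda>x. (utilde S' x - vel S x) /\<^sub>R timestep P) v
        + xi S' * dip (deg P)
            (\<lambda>x. convection (vel S) x
                 + charge P (conc S') x *\<^sub>R grad (phibar S') x) v
        + viscosity P * dip (deg P) (jac (utilde S')) (jac v)
        + dip (deg P) (grad (pres S)) v = 0)"

definition eq_projection :: "params \<Rightarrow> level \<Rightarrow> level \<Rightarrow> bool" where
  "eq_projection P S S' \<longleftrightarrow>
     psi S' \<in> M_space (deg P - 2) \<and>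
     (\<forall>q\<in>M_space (deg P - 2).
        dip (deg P) (grad (psi S')) (grad q)
        = 1 / timestep P * dip (deg P) (utilde S') (grad q)) \<and>
     vel S' \<in> vec_space (X_space (deg P)) \<and>
     (\<forall>x. vel S' x = utilde S' x - timestep P *\<^sub>R grad (psi S') x) \<and>
     pres S' \<in> M_space (deg P - 2) \<and>
     (\<forall>x. pres S' x = psi S' x + pres S x)"

definition eq_sav :: "params \<Rightarrow> level \<Rightarrow> level \<Rightarrow> bool" where
  "eq_sav P S S' \<longleftrightarrow>
     xi S' = sav S' / sqrt (shifted_energy P S') \<and>
     (sav S' - sav S) / timestep P =
       - (1 / (2 * sqrt (shifted_energy P S'))) *
         (xi S' * (\<Sum>i=1..ions P. diffusivity P i *
              dip (deg P) (conc S' i) (\<lambda>x. (norm (grad (mubar P S' i) x))^2))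
          - dip (deg P) (\<lambda>x. charge P (conc S') x *\<^sub>R grad (phibar S') x) (utilde S')
          - dip (deg P) (convection (vel S)) (utilde S'))"

definition eq_phi :: "params \<Rightarrow> level \<Rightarrow> bool" where
  "eq_phi P S' \<longleftrightarrow>
     phi S' \<in> M_space (deg P) \<and> (\<forall>x. phi S' x = xi S' * phibar S' x)"

definition scheme_step :: "params \<Rightarrow> level \<Rightarrow> level \<Rightarrow> bool" where
  "scheme_step P S S' \<longleftrightarrow>
     eq_sigma P S S' \<and> eq_conc P S S' \<and> eq_potential P S' \<and> eq_velocity P S S' \<and>
     eq_projection P S S' \<and> eq_sav P S S' \<and> eq_phi P S'"

definition mass :: "params \<Rightarrow> level \<Rightarrow> nat \<Rightarrow> real" where
  "mass P S i = dip (deg P) (conc S i) (\<lambda>_. 1)"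

text \<open>
  The factor 2 in front of \<open>r\<^sup>2\<close> (instead of 1) is forced by the scheme: testing the velocity equation with
  \<open>2 \<Delta>t\<close> times the intermediate velocity gives the coupling terms with weight \<open>2 \<Delta>t \<xi>\<close>, while
  multiplying the equation for \<open>r\<close> by \<open>2 \<Delta>t r\<close> gives them with weight \<open>- \<Delta>t \<xi>\<close> only. Thus they
  cancel in the sum of the first identity and twice the second, i.e. for (twice) the modified
  energy \<open>\<half>\<parallel>u\<parallel>\<^sup>2 + \<half>\<Delta>t\<^sup>2\<parallel>\<nabla>p\<parallel>\<^sup>2 + r\<^sup>2\<close>, but not if \<open>r\<^sup>2\<close> has weight 1.
\<close>

definition modified_energy :: "params \<Rightarrow> level \<Rightarrow> real" where
  "modified_energy P S =
     (dnorm (deg P) (vel S))^2 + (timestep P)^2 * (dnorm (deg P) (grad (pres S)))^2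
     + 2 * \<bar>sav S\<bar>^2"

end

theory Submission
  imports Defs
begin

text \<open>
  Mass conservation is the purpose of the scalar \<open>\<lambda>\<^sub>i\<close>: the new concentration is
  \<open>\<lambda>\<^sub>i exp(\<sigma>\<^sub>i)\<close>, with \<open>\<lambda>\<^sub>i\<close> chosen such that its discrete mass equals the old one
  (\<open>mass_conserved\<close>). Since an exponential has positive discrete mass, a positive old mass forces
  \<open>\<lambda>\<^sub>i > 0\<close>, and then the new concentration is positive everywhere (\<open>conc_pos\<close>). A concentration
  that is positive on the closed square has positive mass because the quadrature nodes lie in
  \<open>[-1, 1]\<close> (\<open>lgl_nodes_in_interval\<close>) and some weight is positive.

  Energy dissipation comes from three relations, in which every inner product is discrete. Primes mark
  the new level.
  \<^item> Testing the velocity equation with \<open>2 \<Delta>t v\<close>, where \<open>v\<close> is the intermediate velocity, and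
    using \<open>2 (v - u, v) = \<parallel>v\<parallel>\<^sup>2 - \<parallel>u\<parallel>\<^sup>2 + \<parallel>v - u\<parallel>\<^sup>2\<close> bounds
    \<open>\<parallel>v\<parallel>\<^sup>2 - \<parallel>u\<parallel>\<^sup>2 + 2 \<Delta>t (\<nabla>p, v)\<close> by \<open>-2 \<Delta>t \<xi>\<close> times the sum of the convective and
    electrostatic coupling terms (\<open>velocity_inequality\<close>).
  \<^item> The projection step reads \<open>u' + \<Delta>t \<nabla>p' = v + \<Delta>t \<nabla>p\<close>, where \<open>u'\<close> is orthogonal to the
    gradients of the pressure space. Taking norms replaces
    \<open>\<parallel>v\<parallel>\<^sup>2 + 2 \<Delta>t (\<nabla>p, v)\<close> by \<open>\<parallel>u'\<parallel>\<^sup>2 + \<Delta>t\<^sup>2 \<parallel>\<nabla>p'\<parallel>\<^sup>2 - \<Delta>t\<^sup>2 \<parallel>\<nabla>p\<parallel>\<^sup>2\<close> (\<open>projection_identity\<close>).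
  \<^item> Multiplying the equation for \<open>r\<close> by \<open>4 \<Delta>t r'\<close> produces the same coupling terms with the
    factor \<open>+2 \<Delta>t \<xi>\<close>, and a dissipation term of the good sign, since the concentrations are
    nonnegative (\<open>sav_inequality\<close>).

  In the sum of the three the coupling terms cancel. Only symmetry, bilinearity and positive
  semidefiniteness of the discrete inner product enter, and every discarded term has the good
  sign whatever \<open>\<Delta>t > 0\<close> is, which is why the time step is unrestricted.

  For the uniform bounds, mass conservation carries positivity of the masses from the given level
  back to level 0 and from there to all levels, so that the energy decreases along the whole
  sequence from level 1 on. It dominates \<open>\<parallel>u\<parallel>\<^sup>2\<close> and \<open>r\<^sup>2\<close>, and \<open>\<bar>\<xi>\<bar> \<le> \<bar>r\<bar>\<close> because the shifted
  energy is at least 1.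
\<close>

section \<open>Legendre polynomials and the quadrature nodes\<close>

text \<open>
  The recursion without its denominators, as an identity of polynomials, so that it can be both
  evaluated and differentiated.
\<close>

lemma smult_legendre_bonnet:
  "smult (real (n + 2)) (legendre (Suc (Suc n)))
     = smult (real (2 * n + 3)) ([:0, 1:] * legendre (Suc n)) - smult (real (n + 1)) (legendre n)"
proof -
  have "real (n + 2) * ((2 * real n + 3) / (real n + 2)) = real (2 * n + 3)"
    "real (n + 2) * ((real n + 1) / (real n + 2)) = real (n + 1)"
    using of_nat_0_le_iff[of n, where 'a = real]
    by (simp_all add: nonzero_divide_eq_eq mult.commute add.commute)
  then show ?thesis
    unfolding legendre.simps smult_diff_right smult_smult by (simp only:)
qed

lemma legendre_bonnet:
  "real (n + 2) * poly (legendre (Suc (Suc n))) x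
     = real (2 * n + 3) * (x * poly (legendre (Suc n)) x) - real (n + 1) * poly (legendre n) x"
  using arg_cong[OF smult_legendre_bonnet[of n], of "\<lambda>p. poly p x"]
  by (simp del: legendre.simps)

lemma pderiv_legendre_bonnet:
  "real (n + 2) * poly (pderiv (legendre (Suc (Suc n)))) x
     = real (2 * n + 3) * (poly (legendre (Suc n)) x + x * poly (pderiv (legendre (Suc n))) x)
       - real (n + 1) * poly (pderiv (legendre n)) x"
  using arg_cong[OF smult_legendre_bonnet[of n], of "\<lambda>p. poly (pderiv p) x"]
  by (simp add: pderiv_diff pderiv_smult pderiv_mult pderiv_pCons add.commute
      del: legendre.simps mult_pCons_left)

text \<open>
  To the right of 1, Bonnet's recursion propagates monotonicity in the degree, because
  \<open>(2 n + 3) - (n + 1) = n + 2\<close>. It is stated as an inequality so that it also serves for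
  the derivatives, whose recursion has an additional nonnegative term.
\<close>

lemma bonnet_step_mono:
  fixes a b c x :: real
  assumes "real (n + 2) * c \<ge> real (2 * n + 3) * (x * b) - real (n + 1) * a"
    and "x \<ge> 1" "0 \<le> b" "a \<le> b"
  shows "b \<le> c"
proof -
  have "real (n + 2) * b = real (2 * n + 3) * b - real (n + 1) * b"
    by (simp add: algebra_simps)
  also have "\<dots> \<le> real (2 * n + 3) * (x * b) - real (n + 1) * a"
    using assms by (intro diff_mono mult_left_mono) (auto simp: mult_le_cancel_right1)
  also have "\<dots> \<le> real (n + 2) * c" by fact
  finally show ?thesis by simp
qed

lemma legendre_mono_right_of_one:
  assumes "x \<ge> 1"
  shows "0 < poly (legendre n) x \<and> poly (legendre n) x \<le> poly (legendre (Suc n)) x \<and>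
    0 \<le> poly (pderiv (legendre n)) x \<and>
    poly (pderiv (legendre n)) x \<le> poly (pderiv (legendre (Suc n))) x"
proof (induction n)
  case 0
  show ?case using assms by (simp add: pderiv_pCons)
next
  case (Suc n)
  have "poly (legendre (Suc n)) x \<le> poly (legendre (Suc (Suc n))) x"
    by (rule bonnet_step_mono[OF eq_refl[OF legendre_bonnet[symmetric]] assms])
       (use Suc in linarith)+
  moreover have "poly (pderiv (legendre (Suc n))) x \<le> poly (pderiv (legendre (Suc (Suc n)))) x"
  proof (rule bonnet_step_mono[OF _ assms])
    have "0 \<le> real (2 * n + 3) * poly (legendre (Suc n)) x"
      using Suc by (intro mult_nonneg_nonneg) linarith+
    then show "real (2 * n + 3) * (x * poly (pderiv (legendre (Suc n))) x)
        - real (n + 1) * poly (pderiv (legendre n)) x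
        \<le> real (n + 2) * poly (pderiv (legendre (Suc (Suc n)))) x"
      unfolding pderiv_legendre_bonnet distrib_left by linarith
  qed (use Suc in linarith)+
  ultimately show ?case using Suc by linarith
qed

text \<open>
  Monotonicity in the degree leads back to \<open>L'\<^sub>1 = 1\<close>. Together with parity this confines the zeros
  of \<open>L'\<^sub>n\<close>, hence the quadrature nodes, to \<open>[-1, 1]\<close>.
\<close>

lemma pderiv_legendre_pos:
  assumes "x \<ge> 1" "n \<ge> 1"
  shows "0 < poly (pderiv (legendre n)) x"
  using assms(2)
proof (induction n rule: dec_induct)
  case base
  show ?case by (simp add: pderiv_pCons)
next
  case (step n)
  then show ?case using legendre_mono_right_of_one[OF assms(1), of n] by linarith
qed

lemma legendre_parity: "poly (legendre n) (- x) = (- 1) ^ n * poly (legendre n) x"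
  by (induction n rule: legendre.induct) (simp_all add: algebra_simps)

lemma pderiv_legendre_parity:
  "poly (pderiv (legendre n)) (- x) = - ((- 1) ^ n * poly (pderiv (legendre n)) x)"
proof (induction n rule: legendre.induct)
  case (3 n)
  have "real (n + 2) * poly (pderiv (legendre (Suc (Suc n)))) (- x)
      = real (n + 2) * - ((- 1) ^ Suc (Suc n) * poly (pderiv (legendre (Suc (Suc n)))) x)"
    using 3 unfolding pderiv_legendre_bonnet mult_minus_right mult.left_commute[of _ "_ ^ _"]
    by (simp add: legendre_parity[of "Suc n"] algebra_simps)
  then show ?case by (simp only: mult_cancel_left) simp
qed (simp_all add: pderiv_pCons)

lemma one_in_lgl_nodes: "1 \<in> lgl_nodes N"
  by (simp add: lgl_nodes_def)

lemma finite_lgl_nodes: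
  assumes "N \<ge> 1"
  shows "finite (lgl_nodes N)"
proof -
  let ?p = "[:1, 0, - 1:] * pderiv (legendre N)"
  have "pderiv (legendre N) \<noteq> 0"
    using pderiv_legendre_pos[of 1 N] assms by auto
  then have "?p \<noteq> 0" by (simp del: mult_pCons_left)
  moreover have "lgl_nodes N = {x. poly ?p x = 0}"
    by (simp add: lgl_nodes_def power2_eq_square algebra_simps)
  ultimately show ?thesis by (metis poly_roots_finite)
qed

lemma lgl_nodes_in_interval:
  assumes "N \<ge> 1" "s \<in> lgl_nodes N"
  shows "\<bar>s\<bar> \<le> 1"
proof (rule ccontr)
  assume s: "\<not> \<bar>s\<bar> \<le> 1"
  then have "poly (pderiv (legendre N)) \<bar>s\<bar> \<noteq> 0"
    using pderiv_legendre_pos[of "\<bar>s\<bar>" N] assms(1) by auto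
  then have "poly (pderiv (legendre N)) s \<noteq> 0"
    using pderiv_legendre_parity[of N s] by (auto simp: abs_if split: if_splits)
  moreover have "s\<^sup>2 \<noteq> 1" using s by (auto simp: power2_eq_1_iff)
  ultimately show False using assms(2) by (simp add: lgl_nodes_def)
qed

lemma lgl_node_in_closure:
  assumes "N \<ge> 1" "s \<in> lgl_nodes N" "t \<in> lgl_nodes N"
  shows "vector [s, t] \<in> closure Omega"
proof -
  have Omega_box: "Omega = box (\<chi> i. - 1) (\<chi> i. 1)"
    by (auto simp: Omega_def mem_box_cart)
  have "0 \<in> Omega" by (simp add: Omega_def)
  then have "closure Omega = cbox (\<chi> i. - 1) (\<chi> i. 1)"
    unfolding Omega_box by (intro closure_box) auto
  then show ?thesis
    using lgl_nodes_in_interval[OF assms(1,2)] lgl_nodes_in_interval[OF assms(1,3)]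
    by (auto simp: mem_box_cart forall_2 abs_le_iff)
qed

lemma lgl_weight_nonneg: "0 \<le> lgl_weight N s"
  by (simp add: lgl_weight_def)

lemma lgl_weight_one_pos:
  assumes "N \<ge> 1"
  shows "0 < lgl_weight N 1"
  using legendre_mono_right_of_one[of 1 N] assms by (simp add: lgl_weight_def)


section \<open>The discrete inner product\<close>

lemma dip_commute: "dip N f g = dip N g f"
  by (simp add: dip_def inner_commute)

lemma dip_add_left: "dip N (\<lambda>x. f x + g x) h = dip N f h + dip N g h"
  by (simp add: dip_def inner_add_left algebra_simps sum.distrib)

lemma dip_scaleR_left: "dip N (\<lambda>x. a *\<^sub>R f x) h = a * dip N f h"
  by (simp add: dip_def sum_distrib_left algebra_simps)

lemma dip_diff_left: "dip N (\<lambda>x. f x - g x) h = dip N f h - dip N g h"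
  using dip_add_left[of N f "\<lambda>x. (- 1) *\<^sub>R g x"] dip_scaleR_left[of N "- 1" g] by simp

lemma dip_add_right: "dip N h (\<lambda>x. f x + g x) = dip N h f + dip N h g"
  by (simp only: dip_commute[of N h] dip_add_left)

lemma dip_diff_right: "dip N h (\<lambda>x. f x - g x) = dip N h f - dip N h g"
  by (simp only: dip_commute[of N h] dip_diff_left)

lemma dip_scaleR_right: "dip N h (\<lambda>x. a *\<^sub>R f x) = a * dip N h f"
  by (simp only: dip_commute[of N h] dip_scaleR_left)

lemmas dip_bilinear =
  dip_add_left dip_diff_left dip_scaleR_left dip_add_right dip_diff_right dip_scaleR_right

lemma dip_nonneg:
  assumes "\<And>x. 0 \<le> f x \<bullet> g x"
  shows "0 \<le> dip N f g"
  unfolding dip_def by (intro sum_nonneg mult_nonneg_nonneg lgl_weight_nonneg assms)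

lemma dip_self_nonneg: "0 \<le> dip N f f"
  by (simp add: dip_nonneg)

lemma dnorm_square: "(dnorm N f)\<^sup>2 = dip N f f"
  by (simp add: dnorm_def dip_self_nonneg)

text \<open>
  Some node must have positive weight; the corner \<open>(1, 1)\<close> is the one for which this is at hand,
  since \<open>L\<^sub>N(1) > 0\<close>.
\<close>

lemma dip_one_pos:
  fixes f :: scalar_fun
  assumes "N \<ge> 1" and pos: "\<And>x. x \<in> closure Omega \<Longrightarrow> 0 < f x"
  shows "0 < dip N f (\<lambda>_. 1)"
proof -
  let ?t = "\<lambda>s t. lgl_weight N s * lgl_weight N t * (f (vector [s, t]) \<bullet> 1)"
  have nonneg: "0 \<le> ?t s t" if "s \<in> lgl_nodes N" "t \<in> lgl_nodes N" for s t
    using pos[OF lgl_node_in_closure[OF assms(1) that]] by (simp add: lgl_weight_nonneg)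
  have "0 < ?t 1 1"
    using pos[OF lgl_node_in_closure[OF assms(1) one_in_lgl_nodes one_in_lgl_nodes]]
      lgl_weight_one_pos[OF assms(1)] by simp
  also have "\<dots> \<le> (\<Sum>t\<in>lgl_nodes N. ?t 1 t)"
    by (rule member_le_sum[OF one_in_lgl_nodes _ finite_lgl_nodes[OF assms(1)]])
       (use nonneg one_in_lgl_nodes in blast)
  also have "\<dots> \<le> (\<Sum>s\<in>lgl_nodes N. \<Sum>t\<in>lgl_nodes N. ?t s t)"
    by (rule member_le_sum[OF one_in_lgl_nodes _ finite_lgl_nodes[OF assms(1)],
          where f = "\<lambda>s. \<Sum>t\<in>lgl_nodes N. ?t s t"])
       (use nonneg in \<open>auto intro!: sum_nonneg\<close>)
  finally show ?thesis by (simp add: dip_def)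
qed


section \<open>Positivity and mass conservation\<close>

lemma mass_conserved:
  assumes "eq_conc P S S'" "i \<in> {1..ions P}"
  shows "mass P S' i = mass P S i"
proof -
  have c: "conc S' i = (\<lambda>x. lam S' i *\<^sub>R exp (sigma S' i x))"
    using assms by (auto simp: eq_conc_def)
  then have "mass P S' i = lam S' i * dip (deg P) (\<lambda>x. exp (sigma S' i x)) (\<lambda>_. 1)"
    unfolding mass_def by (simp only: dip_scaleR_left)
  also have "\<dots> = mass P S i"
    using assms by (auto simp: eq_conc_def mass_def)
  finally show ?thesis .
qed

lemma conc_pos:
  assumes "eq_conc P S S'" "i \<in> {1..ions P}" "deg P \<ge> 1" "0 < mass P S i"
  shows "0 < conc S' i x"
proof -
  have "0 < dip (deg P) (\<lambda>x. exp (sigma S' i x)) (\<lambda>_. 1)"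
    using assms(3) by (intro dip_one_pos) auto
  moreover have "lam S' i * dip (deg P) (\<lambda>x. exp (sigma S' i x)) (\<lambda>_. 1) = mass P S i"
    using assms(1,2) by (auto simp: eq_conc_def mass_def)
  ultimately have "0 < lam S' i"
    using assms(4) by (metis zero_less_mult_pos2)
  then show ?thesis
    using assms(1,2) by (auto simp: eq_conc_def)
qed


section \<open>Energy dissipation\<close>

lemma X_space_differentiable:
  assumes "f \<in> X_space N"
  shows "f differentiable (at x)"
proof -
  obtain a :: "nat \<Rightarrow> nat \<Rightarrow> real" where
    "f = (\<lambda>x. \<Sum>i\<le>N. \<Sum>j\<le>N. a i j * (x $ 1) ^ i * (x $ 2) ^ j)"
    using assms by (auto simp: X_space_def)
  moreover have "(\<lambda>x::real^2. x $ k) differentiable (at x)" for k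
    by (rule bounded_linear_imp_differentiable[OF bounded_linear_vec_nth])
  ultimately show ?thesis by simp
qed

lemma grad_add:
  assumes "f differentiable (at x)" "g differentiable (at x)"
  shows "grad (\<lambda>y. f y + g y) x = grad f x + grad g x"
  by (simp add: grad_def vec_eq_iff
      frechet_derivative_at[OF has_derivative_add[OF assms[unfolded frechet_derivative_works]],
        symmetric])

text \<open>
  A Pythagorean identity: \<open>u'\<close> is orthogonal to \<open>\<nabla>p'\<close>, so both sides are the squared norm of
  \<open>u' + \<Delta>t \<nabla>p' = v + \<Delta>t \<nabla>p\<close>, with \<open>v\<close> the intermediate velocity.
  The old pressure has to be differentiable for \<open>\<nabla>p' = \<nabla>\<psi> + \<nabla>p\<close>.
\<close>

lemma projection_identity:
  assumes proj: "eq_projection P S S'" and pS: "pres S \<in> X_space K" and h: "timestep P > 0"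
  shows "dip (deg P) (vel S') (vel S')
      + (timestep P)\<^sup>2 * dip (deg P) (grad (pres S')) (grad (pres S'))
    = dip (deg P) (utilde S') (utilde S')
      + 2 * timestep P * dip (deg P) (grad (pres S)) (utilde S')
      + (timestep P)\<^sup>2 * dip (deg P) (grad (pres S)) (grad (pres S))"
proof -
  let ?d = "dip (deg P)" and ?h = "timestep P"
  let ?p = "grad (pres S)" and ?q = "grad (pres S')" and ?g = "grad (psi S')"
  have "psi S' \<in> X_space (deg P - 2)"
    using proj by (auto simp: eq_projection_def M_space_def)
  then have "grad (\<lambda>y. psi S' y + pres S y) x = ?g x + ?p x" for x
    by (intro grad_add X_space_differentiable[OF pS]) (rule X_space_differentiable)
  moreover have "pres S' = (\<lambda>y. psi S' y + pres S y)"
    using proj by (auto simp: eq_projection_def)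
  ultimately have grad_pres: "?q = (\<lambda>x. ?g x + ?p x)"
    by (intro ext) (simp only:)
  have vel: "vel S' = (\<lambda>x. utilde S' x - ?h *\<^sub>R ?g x)"
    using proj by (auto simp: eq_projection_def)
  have "pres S' \<in> M_space (deg P - 2)"
    using proj by (simp add: eq_projection_def)
  \<comment> \<open>the new pressure is itself an admissible test function of the projection step\<close>
  then have "?d ?g ?q = 1 / ?h * ?d (utilde S') ?q"
    using proj by (simp add: eq_projection_def)
  then have "?d (utilde S') ?q = ?h * ?d ?g ?q"
    using h by simp
  then have orth: "?d (vel S') ?q = 0"
    unfolding vel dip_bilinear by simp
  have eq: "(\<lambda>x. vel S' x + ?h *\<^sub>R ?q x) = (\<lambda>x. utilde S' x + ?h *\<^sub>R ?p x)"
    unfolding vel grad_pres by (simp add: algebra_simps)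
  have "?d (\<lambda>x. vel S' x + ?h *\<^sub>R ?q x) (\<lambda>x. vel S' x + ?h *\<^sub>R ?q x)
      = ?d (\<lambda>x. utilde S' x + ?h *\<^sub>R ?p x) (\<lambda>x. utilde S' x + ?h *\<^sub>R ?p x)"
    unfolding eq ..
  then show ?thesis
    unfolding dip_bilinear dip_commute[of _ ?q "vel S'"] dip_commute[of _ "utilde S'" ?p] orth
    by (simp add: power2_eq_square algebra_simps)
qed

text \<open>
  The intermediate velocity is an admissible test function of its own equation. The viscous term and
  \<open>\<parallel>v - u\<parallel>\<^sup>2\<close>, with \<open>v\<close> the intermediate velocity, are nonnegative and dropped.
\<close>

lemma velocity_inequality:
  assumes vel: "eq_velocity P S S'" and "timestep P > 0" "viscosity P > 0"
  shows "dip (deg P) (utilde S') (utilde S') - dip (deg P) (vel S) (vel S)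
      + 2 * timestep P * dip (deg P) (grad (pres S)) (utilde S')
    \<le> - 2 * timestep P * xi S' *
        (dip (deg P) (convection (vel S)) (utilde S')
         + dip (deg P) (\<lambda>x. charge P (conc S') x *\<^sub>R grad (phibar S') x) (utilde S'))"
proof -
  let ?d = "dip (deg P)" and ?h = "timestep P" and ?w = "utilde S'" and ?u = "vel S"
  let ?C = "?d (convection ?u) ?w
      + ?d (\<lambda>x. charge P (conc S') x *\<^sub>R grad (phibar S') x) ?w"
  have "inverse ?h * (?d ?w ?w - ?d ?u ?w) + xi S' * ?C + viscosity P * ?d (jac ?w) (jac ?w)
      + ?d (grad (pres S)) ?w = 0"
    using vel unfolding eq_velocity_def by (auto simp: dip_bilinear dest!: bspec[of _ _ ?w])
  moreover have "0 \<le> viscosity P * ?d (jac ?w) (jac ?w)"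
    using assms(3) by (simp add: dip_self_nonneg)
  ultimately have "inverse ?h * (?d ?w ?w - ?d ?u ?w) \<le> - (xi S' * ?C) - ?d (grad (pres S)) ?w"
    by linarith
  then have "?d ?w ?w - ?d ?u ?w \<le> ?h * (- (xi S' * ?C) - ?d (grad (pres S)) ?w)"
    using assms(2) by (simp add: field_simps)
  moreover have "2 * (?d ?w ?w - ?d ?u ?w) = ?d ?w ?w - ?d ?u ?u
      + ?d (\<lambda>x. ?w x - ?u x) (\<lambda>x. ?w x - ?u x)"
    unfolding dip_bilinear by (simp add: dip_commute[of _ ?w ?u])
  moreover note dip_self_nonneg[of "deg P" "\<lambda>x. ?w x - ?u x"]
  ultimately show ?thesis by (simp add: algebra_simps)
qed

text \<open>
  The equation for \<open>r\<close> multiplied by \<open>4 \<Delta>t r'\<close>. The factor \<open>r' = \<xi> \<surd>(E + C\<^sub>0)\<close> cancels the square root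
  in the denominator and turns the dissipation into \<open>\<xi>\<^sup>2\<close> times a nonnegative sum.
\<close>

lemma sav_inequality:
  assumes sav: "eq_sav P S S'" and "valid_params P" and E: "shifted_energy P S' \<ge> 1"
    and pos: "\<And>i x. i \<in> {1..ions P} \<Longrightarrow> 0 \<le> conc S' i x"
  shows "2 * (sav S')\<^sup>2 - 2 * (sav S)\<^sup>2
    \<le> 2 * timestep P * xi S' *
        (dip (deg P) (convection (vel S)) (utilde S')
         + dip (deg P) (\<lambda>x. charge P (conc S') x *\<^sub>R grad (phibar S') x) (utilde S'))"
proof -
  let ?h = "timestep P" and ?r = "sav S" and ?r' = "sav S'" and ?x = "xi S'"
  let ?C = "dip (deg P) (convection (vel S)) (utilde S')
      + dip (deg P) (\<lambda>x. charge P (conc S') x *\<^sub>R grad (phibar S') x) (utilde S')"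
  let ?e = "sqrt (shifted_energy P S')"
  define D where "D = (\<Sum>i=1..ions P. diffusivity P i *
    dip (deg P) (conc S' i) (\<lambda>x. (norm (grad (mubar P S' i) x))\<^sup>2))"
  have h: "?h > 0" and e: "?e > 0"
    using assms(2) E by (auto simp: valid_params_def)
  have "0 \<le> D"
    unfolding D_def using assms(2) pos
    by (intro sum_nonneg mult_nonneg_nonneg dip_nonneg) (auto simp: valid_params_def less_imp_le)
  then have D: "0 \<le> ?h * (?x\<^sup>2 * D)" using h by simp
  have r': "?r' = ?x * ?e"
    using sav e by (simp add: eq_sav_def)
  have "?x * D - ?C = ?x * D
      - dip (deg P) (\<lambda>x. charge P (conc S') x *\<^sub>R grad (phibar S') x) (utilde S')
      - dip (deg P) (convection (vel S)) (utilde S')"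
    by simp
  then have "(?r' - ?r) / ?h = - (1 / (2 * ?e)) * (?x * D - ?C)"
    using sav unfolding eq_sav_def D_def by (simp only:)
  then have "2 * ?e * (?r' - ?r) = - ?h * (?x * D - ?C)"
    using h e by (simp add: field_simps)
  then have "?x * (2 * ?e * (?r' - ?r)) = ?x * (- ?h * (?x * D - ?C))"
    by (rule arg_cong)
  moreover have "?x * (2 * ?e * (?r' - ?r)) = 2 * ?r' * (?r' - ?r)"
    unfolding r' by (simp only: mult_ac)
  moreover have "?x * (- ?h * (?x * D - c)) = - (?h * (?x\<^sup>2 * D)) + ?h * ?x * c" for c
    by (simp add: power2_eq_square algebra_simps)
  ultimately have "2 * ?r' * (?r' - ?r) = - (?h * (?x\<^sup>2 * D)) + ?h * ?x * ?C"
    by (simp only:)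
  moreover have "2 * ?r' * (?r' - ?r) = ?r'\<^sup>2 - ?r\<^sup>2 + (?r' - ?r)\<^sup>2"
    by (simp add: power2_eq_square algebra_simps)
  moreover have "0 \<le> (?r' - ?r)\<^sup>2" by simp
  ultimately have "?r'\<^sup>2 - ?r\<^sup>2 \<le> ?h * ?x * ?C" using D by linarith
  then show ?thesis by linarith
qed

lemma energy_dissipation:
  assumes "valid_params P" "scheme_step P S S'" "shifted_energy P S' \<ge> 1"
    and "pres S \<in> X_space K"
    and "\<And>i x. i \<in> {1..ions P} \<Longrightarrow> 0 \<le> conc S' i x"
  shows "modified_energy P S' \<le> modified_energy P S"
proof -
  have param_pos: "timestep P > 0" "viscosity P > 0"
    using assms(1) by (auto simp: valid_params_def)
  have "eq_velocity P S S'" "eq_projection P S S'" "eq_sav P S S'"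
    using assms(2) by (auto simp: scheme_step_def)
  then show ?thesis
    using projection_identity[OF _ assms(4) param_pos(1)] velocity_inequality[OF _ param_pos]
      sav_inequality[OF _ assms(1,3,5)]
    unfolding modified_energy_def dnorm_square power2_abs by fastforce
qed


section \<open>Boundedness\<close>

text \<open>
  The scheme constrains only the levels from 1 on: \<open>\<xi>\<close> at level 0 is arbitrary initial data, and so
  is the pressure, which need not be a polynomial there. Hence the estimates start at level 1,
  and level 0 contributes a single extra value.
\<close>

lemma bounded_of_tail_bound:
  fixes f :: "nat \<Rightarrow> real"
  assumes "\<And>k. \<bar>f (Suc k)\<bar> \<le> B"
  shows "bounded (range f)"
proof (rule boundedI)
  fix y assume "y \<in> range f"
  then obtain k where "y = f k" by blast
  then show "norm y \<le> max B \<bar>f 0\<bar>"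
    using assms by (cases k) (auto simp: le_max_iff_disj)
qed

lemma vel_le_energy: "\<bar>dnorm (deg P) (vel S)\<bar> \<le> sqrt (modified_energy P S)"
  by (rule real_le_rsqrt) (simp add: modified_energy_def)

lemma sav_le_energy: "\<bar>sav S\<bar> \<le> sqrt (modified_energy P S)"
  by (rule real_le_rsqrt) (simp add: modified_energy_def)

lemma xi_le_sav:
  assumes "eq_sav P S S'" "shifted_energy P S' \<ge> 1"
  shows "\<bar>xi S'\<bar> \<le> \<bar>sav S'\<bar>"
proof -
  have "1 \<le> sqrt (shifted_energy P S')" using assms(2) by simp
  then have "\<bar>sav S'\<bar> / sqrt (shifted_energy P S') \<le> \<bar>sav S'\<bar> / 1"
    by (intro divide_left_mono) auto
  then show ?thesis using assms by (simp add: eq_sav_def)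
qed

lemma scheme_bounded:
  assumes P: "valid_params P"
    and step: "\<And>k. scheme_step P (S k) (S (Suc k))"
    and E: "\<And>k. shifted_energy P (S (Suc k)) \<ge> 1"
    and mass0: "\<And>i. i \<in> {1..ions P} \<Longrightarrow> 0 < mass P (S 0) i"
  shows "bounded (range (\<lambda>k. dnorm (deg P) (vel (S k)))) \<and>
    bounded (range (\<lambda>k. \<bar>sav (S k)\<bar>)) \<and> bounded (range (\<lambda>k. \<bar>xi (S k)\<bar>))"
proof -
  have conc: "eq_conc P (S k) (S (Suc k))" and sav: "eq_sav P (S k) (S (Suc k))"
    and proj: "eq_projection P (S k) (S (Suc k))" for k
    using step[of k] by (auto simp: scheme_step_def)
  have "0 < mass P (S k) i" if "i \<in> {1..ions P}" for k i
    using mass0[OF that] by (induction k) (simp_all add: mass_conserved[OF conc that])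
  moreover have "deg P \<ge> 1" using P by (simp add: valid_params_def)
  ultimately have pos: "0 \<le> conc (S (Suc k)) i x" if "i \<in> {1..ions P}" for k i x
    using conc_pos[OF conc that] that less_imp_le by blast
  have pres: "pres (S (Suc k)) \<in> X_space (deg P - 2)" for k
    using proj[of k] by (simp add: eq_projection_def M_space_def)
  have "modified_energy P (S (Suc k)) \<le> modified_energy P (S (Suc 0))" for k
  proof (induction k)
    case (Suc k)
    then show ?case
      using energy_dissipation[OF P step E pres pos, of k] by linarith
  qed simp
  then have B: "sqrt (modified_energy P (S (Suc k))) \<le> sqrt (modified_energy P (S (Suc 0)))" for k
    by simp
  show ?thesis
  proof (intro conjI)
    show "bounded (range (\<lambda>k. dnorm (deg P) (vel (S k))))"
      using order_trans[OF vel_le_energy B] by (rule bounded_of_tail_bound)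
    show "bounded (range (\<lambda>k. \<bar>sav (S k)\<bar>))"
      using order_trans[OF sav_le_energy B] by (intro bounded_of_tail_bound) simp
    show "bounded (range (\<lambda>k. \<bar>xi (S k)\<bar>))"
      using order_trans[OF xi_le_sav[OF sav E] order_trans[OF sav_le_energy B]]
      by (intro bounded_of_tail_bound) simp
  qed
qed


section \<open>The properties of the scheme\<close>

theorem theorem4p1p1:
  fixes P :: params and S :: "nat \<Rightarrow> level" and n :: nat
  assumes "valid_params P"
    and "level_data P (S n)"
    and "\<forall>i\<in>{1..ions P}. \<forall>x\<in>closure Omega. conc (S n) i x > 0"
    and "\<forall>i\<in>{1..ions P}. mass P (S n) i = mass P (S 0) i"
    and "scheme_step P (S n) (S (Suc n))"
    and "shifted_energy P (S (Suc n)) \<ge> 1"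
  shows "(\<forall>i\<in>{1..ions P}. \<forall>x\<in>closure Omega. conc (S (Suc n)) i x > 0) \<and>
    (\<forall>i\<in>{1..ions P}. mass P (S (Suc n)) i = mass P (S n) i) \<and>
    modified_energy P (S (Suc n)) - modified_energy P (S n) \<le> 0 \<and>
    ((\<forall>k. scheme_step P (S k) (S (Suc k)) \<and> shifted_energy P (S (Suc k)) \<ge> 1) \<longrightarrow>
      bounded (range (\<lambda>k. dnorm (deg P) (vel (S k)))) \<and>
      bounded (range (\<lambda>k. \<bar>sav (S k)\<bar>)) \<and>
      bounded (range (\<lambda>k. \<bar>xi (S k)\<bar>)))"
proof -
  have N: "deg P \<ge> 1" using assms(1) by (auto simp: valid_params_def)
  have conc: "eq_conc P (S n) (S (Suc n))"
    using assms(5) by (simp add: scheme_step_def)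
  have massn: "0 < mass P (S n) i" if "i \<in> {1..ions P}" for i
    using dip_one_pos[OF N] assms(3) that by (auto simp: mass_def)
  have pos: "0 < conc (S (Suc n)) i x" if "i \<in> {1..ions P}" for i x
    by (rule conc_pos[OF conc that N massn[OF that]])
  have "pres (S n) \<in> X_space (deg P - 2)"
    using assms(2) by (simp add: level_data_def M_space_def)
  then have dissipation: "modified_energy P (S (Suc n)) \<le> modified_energy P (S n)"
    using energy_dissipation[OF assms(1,5,6)] pos by (simp add: less_imp_le)
  have "0 < mass P (S 0) i" if "i \<in> {1..ions P}" for i
    using massn[OF that] assms(4) that by simp
  then have bounds: "bounded (range (\<lambda>k. dnorm (deg P) (vel (S k)))) \<and>
      bounded (range (\<lambda>k. \<bar>sav (S k)\<bar>)) \<and> bounded (range (\<lambda>k. \<bar>xi (S k)\<bar>))"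
    if "\<forall>k. scheme_step P (S k) (S (Suc k)) \<and> shifted_energy P (S (Suc k)) \<ge> 1"
    using that by (intro scheme_bounded[OF assms(1)]) blast+
  show ?thesis
    by (intro conjI ballI impI)
       (simp_all add: pos mass_conserved[OF conc] dissipation bounds)
qed

end
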